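(* If $G$ is a $2$-edge connected finite simple graph with order $n$ and maximum degree $\Delta$, then \[ \mathrm{mof}(G) \leq \frac{ (\lceil \frac{\Delta}{2} \rceil -1) n + 1}{ \lceil \frac{\Delta}{2} \rceil}. \]
   Context: An orientation $D$ of a simple graph $G$ assigns to each edge exactly one direction; if $(u,v)$ is an arc, $v$ is an out-neighbor of $u$. Oriented $1$-forcing: starting from a nonempty set $S$ of colored vertices, repeatedly, any colored vertex with at most one non-colored out-neighbor forces that out-neighbor to become colored (all forcings in a step simultaneous), until no change occurs; $S$ is a forcing set if all vertices end up colored. $F(D)$ is the minimum size of a forcing set of $D$, and $\mathrm{mof}(G)$ is the minimum of $F(D)$ over all orientations $D$ of $G$. *)

theory Defs
  imports Complex_Main "Graph_Theory.Graph_Theory"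
begin

text \<open>
  A finite simple graph is a \<^locale>\<open>pair_graph\<close>: a finite, loop-free, symmetric set of arcs,
  in which the undirected edge between \<open>u\<close> and \<open>v\<close> is represented by the two
  arcs \<open>(u, v)\<close> and \<open>(v, u)\<close>.
\<close>

definition edge_set :: "'a pair_pre_digraph \<Rightarrow> 'a set set" where
  "edge_set G = {{u, v} | u v. (u, v) \<in> parcs G}"

definition del_edges :: "'a pair_pre_digraph \<Rightarrow> 'a set set \<Rightarrow> 'a pair_pre_digraph" where
  "del_edges G F = \<lparr> pverts = pverts G, parcs = {(u, v) \<in> parcs G. {u, v} \<notin> F} \<rparr>"

text \<open>
  The usual convention is followed that a \<open>k\<close>-edge connected graph has at least two vertices;
  in particular the one-vertex graph (which has maximum degree \<open>0\<close>) is not 2-edge connected.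
  The name \<open>connected\<close> is qualified because of the topological notion of the same name.
\<close>

definition edge_connected :: "nat \<Rightarrow> 'a pair_pre_digraph \<Rightarrow> bool" where
  "edge_connected k G \<longleftrightarrow>
     card (pverts G) > 1 \<and>
     (\<forall>F \<subseteq> edge_set G. card F < k \<longrightarrow> Digraph_Component.connected (with_proj (del_edges G F)))"

text \<open>In a symmetric arc set, the degree of a vertex is its out-degree.\<close>

definition max_degree :: "'a pair_pre_digraph \<Rightarrow> nat" where
  "max_degree G = Max (out_degree (with_proj G) ` pverts G)"

definition orientation :: "'a pair_pre_digraph \<Rightarrow> 'a pair_pre_digraph \<Rightarrow> bool" where
  "orientation G D \<longleftrightarrow>
     pverts D = pverts G \<and> parcs D \<subseteq> parcs G \<and>
     (\<forall>(u, v) \<in> parcs G. (u, v) \<in> parcs D \<longleftrightarrow> (v, u) \<notin> parcs D)"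

definition out_neighbors :: "'a pair_pre_digraph \<Rightarrow> 'a \<Rightarrow> 'a set" where
  "out_neighbors D v = {w. (v, w) \<in> parcs D}"

text \<open>One step of the oriented 1-forcing process, with all forcings carried out simultaneously.\<close>

definition force_step :: "'a pair_pre_digraph \<Rightarrow> 'a set \<Rightarrow> 'a set" where
  "force_step D S =
     S \<union> \<Union> {out_neighbors D v - S | v. v \<in> S \<and> card (out_neighbors D v - S) \<le> 1}"

text \<open>
  The sets \<open>(force_step D ^^ t) S\<close> increase with \<open>t\<close>, so on a finite digraph the final set of
  coloured vertices is everything iff everything is coloured after some number of steps.
\<close>

definition forcing_set :: "'a pair_pre_digraph \<Rightarrow> 'a set \<Rightarrow> bool" where
  "forcing_set D S \<longleftrightarrow>
     S \<noteq> {} \<and> S \<subseteq> pverts D \<and> (\<exists>t. (force_step D ^^ t) S = pverts D)"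

definition forcing_number :: "'a pair_pre_digraph \<Rightarrow> nat" where
  "forcing_number D = Min (card ` {S. forcing_set D S})"

definition mof :: "'a pair_pre_digraph \<Rightarrow> nat" where
  "mof G = Min (forcing_number ` {D. orientation G D})"

end

theory Submission
  imports Defs
begin

text \<open>
  Let \<open>k = \<lceil>\<Delta>/2\<rceil>\<close>. If an orientation has all out-degrees at most \<open>k\<close> and every vertex is reachable from
  a root \<open>r\<close>, colour greedily from \<open>r\<close>: as long as some coloured vertex has \<open>j \<ge> 1\<close> uncoloured
  out-neighbours, put \<open>j - 1\<close> of them into the forcing set and let the last one be forced. Since
  \<open>j \<le> k\<close>, at most a fraction \<open>(k - 1)/k\<close> of the vertices other than \<open>r\<close> is chosen.

  Such an orientation minimises the total excess of out-degrees over \<open>k\<close> among all orientations with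
  root \<open>r\<close>. Suppose that \<open>v\<close> had out-degree above \<open>k\<close>, and let \<open>Z\<close> be the set of vertices reachable
  from \<open>v\<close>. Reversing a path from \<open>v\<close> to a vertex \<open>w\<close> of out-degree below \<open>k\<close> would be an
  improvement, so every such \<open>w\<close> lies in a set \<open>A\<close> that omits \<open>r\<close> and \<open>v\<close> and has in-degree 1; then
  \<open>A \<subseteq> Z\<close>. The maximal sets of this kind inside \<open>Z\<close> are disjoint by submodularity, and at least one arc
  leaves each of them because there are no bridges. Adding up out-degree minus in-degree over \<open>Z\<close>
  gives a positive number, although no arc leaves \<open>Z\<close>.
\<close>

section \<open>Cuts in finite relations\<close>

text \<open>Complements are taken in the whole type, so \<open>into D (- B)\<close> counts the arcs
  leaving \<open>B\<close>, and without loops \<open>into D (- {v})\<close> is the out-degree of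
  \<open>v\<close>.\<close>

definition into :: "('a \<times> 'a) set \<Rightarrow> 'a set \<Rightarrow> nat" where
  "into D B = card (D \<inter> (- B) \<times> B)"

definition excess :: "('a \<times> 'a) set \<Rightarrow> 'a set \<Rightarrow> int" where
  "excess D B = int (into D (- B)) - int (into D B)"

lemma into_eq_sum:
  assumes "finite D"
  shows "into D B = (\<Sum>(a, b)\<in>D. of_bool (a \<notin> B \<and> b \<in> B))"
proof -
  have "D \<inter> (- B) \<times> B = D \<inter> {e. fst e \<notin> B \<and> snd e \<in> B}" by auto
  then show ?thesis using assms by (simp add: into_def case_prod_beta of_bool_def sum.If_cases)
qed

lemma excess_eq_sum:
  assumes "finite D"
  shows "excess D B = (\<Sum>(a, b)\<in>D. of_bool (a \<in> B) - of_bool (b \<in> B))"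
  unfolding excess_def into_eq_sum[OF assms] of_nat_sum sum_subtractf[symmetric]
  by (rule sum.cong) auto

text \<open>An arc inside \<open>B\<close> adds 1 at its tail and -1 at its head, so only arcs
  across the boundary survive.\<close>

lemma excess_eq_sum_vertices:
  assumes "finite D" "finite B"
  shows "excess D B = (\<Sum>v\<in>B. excess D {v})"
proof -
  have "(\<Sum>v\<in>B. excess D {v}) = (\<Sum>(a, b)\<in>D. \<Sum>v\<in>B. of_bool (a = v) - of_bool (b = v))"
    unfolding excess_eq_sum[OF assms(1)] by (subst sum.swap) (simp add: case_prod_beta)
  also have "\<dots> = (\<Sum>(a, b)\<in>D. of_bool (a \<in> B) - of_bool (b \<in> B))"
    using assms(2) by (intro sum.cong) (auto simp: sum_subtractf of_bool_def)
  finally show ?thesis by (simp add: excess_eq_sum[OF assms(1)])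
qed

lemma excess_Un:
  assumes "finite D" "finite A" "finite B" "A \<inter> B = {}"
  shows "excess D (A \<union> B) = excess D A + excess D B"
  using assms excess_eq_sum_vertices[of D A] excess_eq_sum_vertices[of D B]
    excess_eq_sum_vertices[of D "A \<union> B"]
  by (simp add: sum.union_disjoint)

lemma excess_Union:
  assumes "finite D" "finite F" "\<forall>A\<in>F. finite A" "pairwise disjnt F"
  shows "excess D (\<Union>F) = (\<Sum>A\<in>F. excess D A)"
proof -
  have "excess D (\<Union>F) = (\<Sum>v\<in>\<Union>F. excess D {v})"
    using assms by (intro excess_eq_sum_vertices) auto
  also have "\<dots> = (\<Sum>A\<in>F. \<Sum>v\<in>A. excess D {v})"
    using assms by (subst sum.Union_disjoint) (auto simp: pairwise_def disjnt_def)
  also have "\<dots> = (\<Sum>A\<in>F. excess D A)"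
    using assms by (intro sum.cong excess_eq_sum_vertices[symmetric]) auto
  finally show ?thesis .
qed

text \<open>Checked arc by arc; the two sides differ by the number of arcs between
  \<open>A - B\<close> and \<open>B - A\<close>.\<close>

lemma into_submodular:
  assumes "finite D"
  shows "into D (A \<union> B) + into D (A \<inter> B) \<le> into D A + into D B"
  unfolding into_eq_sum[OF assms] sum.distrib[symmetric]
  by (rule sum_mono) auto

lemma into_pos_iff:
  assumes "finite D"
  shows "0 < into D B \<longleftrightarrow> (\<exists>a b. (a, b) \<in> D \<and> a \<notin> B \<and> b \<in> B)"
  using assms by (auto simp: into_def card_gt_0_iff)

section \<open>Reachability and paths as sets of arcs\<close>

lemma rtrancl_enters:
  assumes "(v, w) \<in> D\<^sup>*" "v \<notin> B" "w \<in> B"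
  shows "\<exists>a b. (v, a) \<in> D\<^sup>* \<and> (a, b) \<in> D \<and> a \<notin> B \<and> b \<in> B"
  using assms by (induction rule: rtrancl_induct) auto

text \<open>Cut the walk at its last visit to \<open>v\<close>.\<close>

lemma rtrancl_first_step:
  assumes "(v, w) \<in> D\<^sup>*" "v \<noteq> w"
  shows "\<exists>x. (v, x) \<in> D \<and> (x, w) \<in> {e \<in> D. fst e \<noteq> v}\<^sup>*"
  using assms
proof (induction rule: rtrancl_induct)
  case (step y z)
  show ?case
  proof (cases "y = v")
    case False
    with step obtain x where "(v, x) \<in> D" "(x, y) \<in> {e \<in> D. fst e \<noteq> v}\<^sup>*" by auto
    moreover have "(y, z) \<in> {e \<in> D. fst e \<noteq> v}" using step False by auto
    ultimately show ?thesis by (meson rtrancl.rtrancl_into_rtrancl)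
  qed (use step in auto)
qed simp

text \<open>\<open>P\<close> is the arc set of a path, recorded only by its boundary. Discarding all
  arcs out of \<open>v\<close> after the first step keeps the new arc outside the rest of the path,
  so it counts exactly once.\<close>

lemma exists_path_arcs:
  assumes "finite D" "(v, w) \<in> D\<^sup>*"
  shows "\<exists>P\<subseteq>D. \<forall>B. excess P B = of_bool (v \<in> B) - of_bool (w \<in> B)"
  using assms
proof (induction "card D" arbitrary: D v rule: less_induct)
  case less
  show ?case
  proof (cases "v = w")
    case True
    then show ?thesis by (intro exI[of _ "{}"]) (simp add: excess_eq_sum)
  next
    case False
    let ?D = "{e \<in> D. fst e \<noteq> v}"
    obtain x where x: "(v, x) \<in> D" "(x, w) \<in> ?D\<^sup>*"
      using rtrancl_first_step[OF less.prems(2) False] by auto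
    have "(v, x) \<in> D - ?D" using x(1) by simp
    then have "?D \<subset> D" by blast
    then have "card ?D < card D" using less.prems(1) by (rule psubset_card_mono[rotated])
    then obtain P where P: "P \<subseteq> ?D" "\<forall>B. excess P B = of_bool (x \<in> B) - of_bool (w \<in> B)"
      using less.hyps[of ?D x] x(2) less.prems(1) by auto
    have fin: "finite P" using P(1) less.prems(1) finite_subset[of P D] by auto
    have "(v, x) \<notin> P" using P(1) by auto
    then have "excess (insert (v, x) P) B = of_bool (v \<in> B) - of_bool (w \<in> B)" for B
      using P(2) fin by (simp add: excess_eq_sum)
    then show ?thesis using P(1) x(1) by (intro exI[of _ "insert (v, x) P"]) auto
  qed
qed

section \<open>Orientations of bridgeless graphs\<close>

definition orients :: "('a \<times> 'a) set \<Rightarrow> ('a \<times> 'a) set \<Rightarrow> bool" where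
  "orients E D \<longleftrightarrow> E = D \<union> D\<inverse> \<and> D \<inter> D\<inverse> = {}"

text \<open>Reachability from \<open>r\<close>, stated through cuts so that changes of in-degree and
  submodularity apply directly.\<close>

definition rooted :: "'a set \<Rightarrow> 'a \<Rightarrow> ('a \<times> 'a) set \<Rightarrow> bool" where
  "rooted V r D \<longleftrightarrow> (\<forall>B\<subseteq>V. B \<noteq> {} \<and> r \<notin> B \<longrightarrow> 0 < into D B)"

text \<open>Arcs of \<open>P\<close> leaving \<open>B\<close> become entering ones and conversely;
  no reversed arc is already in \<open>D\<close>.\<close>

lemma into_reverse:
  assumes "finite D" "P \<subseteq> D" "D \<inter> D\<inverse> = {}"
  shows "int (into ((D - P) \<union> P\<inverse>) B) = int (into D B) + excess P B"
proof -
  have fin: "finite P" using assms(1,2) finite_subset by blast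
  have "((D - P) \<union> P\<inverse>) \<inter> (- B) \<times> B = (D - P) \<inter> (- B) \<times> B \<union> P\<inverse> \<inter> (- B) \<times> B"
    by auto
  moreover have "((D - P) \<inter> (- B) \<times> B) \<inter> (P\<inverse> \<inter> (- B) \<times> B) = {}" using assms by auto
  ultimately have "into ((D - P) \<union> P\<inverse>) B = into (D - P) B + into (P\<inverse>) B"
    using assms(1) fin by (simp add: into_def card_Un_disjoint)
  moreover have "into (P\<inverse>) B = into P (- B)"
  proof -
    have "P\<inverse> \<inter> (- B) \<times> B = (P \<inter> B \<times> (- B))\<inverse>" by auto
    then show ?thesis by (simp add: into_def)
  qed
  moreover have "into D B = into (D - P) B + into P B"
    using sum.subset_diff[OF assms(2,1)] assms(1) fin by (simp add: into_eq_sum)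
  ultimately show ?thesis by (simp add: excess_def)
qed

lemma orients_reverse:
  assumes "orients E D" "P \<subseteq> D"
  shows "orients E ((D - P) \<union> P\<inverse>)"
  using assms unfolding orients_def by auto

text \<open>As \<open>E\<close> is symmetric, \<open>into E A\<close> counts each undirected edge
  across the cut once; in particular \<open>into E {x}\<close> is the degree of
  \<open>x\<close>.\<close>

locale bridgeless =
  fixes V :: "'a set" and E :: "('a \<times> 'a) set"
  assumes fin_V: "finite V"
    and E_sub: "E \<subseteq> V \<times> V"
    and E_sym: "sym E"
    and E_irrefl: "irrefl E"
    and cut: "\<And>A. A \<subseteq> V \<Longrightarrow> A \<noteq> {} \<Longrightarrow> A \<noteq> V \<Longrightarrow> 2 \<le> into E A"
begin

lemma fin_E: "finite E"
  using fin_V E_sub finite_subset by blast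

lemma orients_finite: "orients E D \<Longrightarrow> finite D"
  using fin_E by (auto simp: orients_def)

lemma orients_sub: "orients E D \<Longrightarrow> D \<subseteq> V \<times> V"
  using E_sub by (auto simp: orients_def)

lemma into_orients:
  assumes "orients E D"
  shows "into E B = into D B + into D (- B)"
proof -
  have "E \<inter> (- B) \<times> B = D \<inter> (- B) \<times> B \<union> (D \<inter> B \<times> (- B))\<inverse>"
    using assms by (auto simp: orients_def)
  moreover have "(D \<inter> (- B) \<times> B) \<inter> (D \<inter> B \<times> (- B))\<inverse> = {}"
    using assms by (auto simp: orients_def)
  ultimately show ?thesis
    using orients_finite[OF assms] by (simp add: into_def card_Un_disjoint)
qed

lemma exists_orients: "\<exists>D. orients E D"
proof -
  obtain f :: "'a \<Rightarrow> nat" where f: "inj_on f V"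
    using finite_imp_inj_to_nat_seg[OF fin_V] by auto
  have "f a \<noteq> f b" if "(a, b) \<in> E" for a b
    using that f E_sub E_irrefl by (auto simp: inj_on_def irrefl_def)
  then have "orients E {(a, b) \<in> E. f a < f b}"
    using E_sym by (fastforce simp: orients_def sym_def)
  then show ?thesis ..
qed

text \<open>Take an orientation reaching the most vertices from \<open>r\<close>. If some are
  missed, an edge of the cut points inwards; its tail is unreachable, so no path from
  \<open>r\<close> uses it, and flipping it reaches more.\<close>

lemma exists_rooted:
  assumes "r \<in> V"
  shows "\<exists>D. orients E D \<and> rooted V r D"
proof -
  define R where "R D = D\<^sup>* `` {r}" for D :: "('a \<times> 'a) set"
  have R_sub: "R D \<subseteq> V" if "orients E D" for D
  proof
    fix x assume "x \<in> R D"
    then have "(r, x) \<in> D\<^sup>*" by (simp add: R_def)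
    then show "x \<in> V" using orients_sub[OF that] assms by (induction rule: rtrancl_induct) auto
  qed
  then have "\<forall>D. orients E D \<longrightarrow> card (R D) < Suc (card V)"
    using card_mono[OF fin_V] by (simp add: less_Suc_eq_le)
  moreover obtain D0 where "orients E D0" using exists_orients ..
  ultimately obtain D where D: "orients E D"
    and max: "\<And>D'. orients E D' \<Longrightarrow> card (R D') \<le> card (R D)"
    using ex_has_greatest_nat[of "orients E" D0 "\<lambda>D. card (R D)" "Suc (card V)"] by blast
  have "R D = V"
  proof (rule ccontr)
    assume ne: "R D \<noteq> V"
    have "r \<in> R D" by (simp add: R_def)
    then have "R D \<noteq> {}" by blast
    then have "0 < into E (R D)"
      using cut[OF R_sub[OF D] _ ne] by simp
    then obtain x y where xy: "(x, y) \<in> E" "x \<notin> R D" "y \<in> R D"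
      using into_pos_iff[OF fin_E] by blast
    have "(y, x) \<notin> D" using xy(2,3) by (auto simp: R_def intro: rtrancl_into_rtrancl)
    then have "(x, y) \<in> D" using xy(1) D by (auto simp: orients_def)
    define D' where "D' = (D - {(x, y)}) \<union> {(x, y)}\<inverse>"
    have o: "orients E D'" unfolding D'_def using D \<open>(x, y) \<in> D\<close> by (intro orients_reverse) auto
    have sub: "z \<in> R D'" if "z \<in> R D" for z
    proof -
      from that have "(r, z) \<in> D\<^sup>*" by (simp add: R_def)
      then show ?thesis
      proof (induction rule: rtrancl_induct)
        case (step a b)
        have "a \<noteq> x" using step(1) xy(2) by (auto simp: R_def)
        then have "(a, b) \<in> D'" using step(2) by (simp add: D'_def)
        then show ?case using step(3) by (auto simp: R_def intro: rtrancl_into_rtrancl)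
      qed (simp add: R_def)
    qed
    have "(y, x) \<in> D'" by (simp add: D'_def)
    then have "x \<in> R D'" using sub[OF xy(3)] by (auto simp: R_def intro: rtrancl_into_rtrancl)
    then have "R D \<subset> R D'" using sub xy(2) by auto
    then have "card (R D) < card (R D')"
      using R_sub[OF o] fin_V by (meson finite_subset psubset_card_mono)
    with max[OF o] show False by simp
  qed
  have "rooted V r D"
    unfolding rooted_def
  proof (intro allI impI)
    fix B assume B: "B \<subseteq> V" "B \<noteq> {} \<and> r \<notin> B"
    then obtain b where "b \<in> B" "(r, b) \<in> D\<^sup>*" using \<open>R D = V\<close> by (auto simp: R_def)
    then show "0 < into D B"
      using rtrancl_enters[of r b D B] B into_pos_iff[OF orients_finite[OF D]] by blast
  qed
  with D show ?thesis by blast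
qed

text \<open>A set is tight if it misses the root \<open>r\<close> and only one arc enters it. A path from \<open>v\<close> to \<open>w\<close> can
  be reversed without losing the root property unless a tight set separates \<open>w\<close> from \<open>v\<close>.\<close>

lemma tight_subset_reachable:
  assumes D: "orients E D" "rooted V r D"
    and B: "B \<subseteq> V" "r \<notin> B" "into D B = 1" "v \<notin> B" "w \<in> B" "(v, w) \<in> D\<^sup>*"
  shows "B \<subseteq> D\<^sup>* `` {v}"
proof (rule ccontr)
  let ?Z = "D\<^sup>* `` {v}"
  note fin = orients_finite[OF D(1)]
  assume "\<not> B \<subseteq> ?Z"
  \<comment> \<open>Two arcs enter \<open>B\<close>: one with unreachable tail, found by rootedness,
    and one on the path from \<open>v\<close>, with reachable tail.\<close>
  then have "0 < into D (B - ?Z)"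
    using D(2) B(1,2) unfolding rooted_def by (metis Diff_eq_empty_iff Diff_iff Diff_subset subset_trans)
  then obtain a b where ab: "(a, b) \<in> D" "a \<notin> B - ?Z" "b \<in> B - ?Z"
    using into_pos_iff[OF fin] by blast
  have "a \<notin> ?Z" using ab by (auto intro: rtrancl_into_rtrancl)
  obtain c d where cd: "(v, c) \<in> D\<^sup>*" "(c, d) \<in> D" "c \<notin> B" "d \<in> B"
    using rtrancl_enters[OF B(6,4,5)] by blast
  have "{(a, b), (c, d)} \<subseteq> D \<inter> (- B) \<times> B" using ab cd \<open>a \<notin> ?Z\<close> by auto
  then have "card {(a, b), (c, d)} \<le> into D B"
    unfolding into_def using fin by (intro card_mono) auto
  moreover have "a \<noteq> c" using cd(1) \<open>a \<notin> ?Z\<close> by auto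
  ultimately show False using B(3) by simp
qed

text \<open>Finds the end \<open>w\<close> of a path to reverse: \<open>w\<close> has room for
  another out-arc, and no tight set loses its only entering arc.\<close>

lemma exists_unsaturated:
  assumes D: "orients E D" "rooted V r D"
    and r: "r \<in> V"
    and deg: "\<And>x. x \<in> V \<Longrightarrow> into E {x} \<le> 2 * k"
    and v: "v \<in> V" "k < into D (- {v})"
  shows "\<exists>w\<in>V. (v, w) \<in> D\<^sup>* \<and> into D (- {w}) < k \<and>
    (\<forall>B\<subseteq>V. r \<notin> B \<and> v \<notin> B \<and> w \<in> B \<longrightarrow> into D B \<noteq> 1)"
proof (rule ccontr)
  assume contra: "\<not> ?thesis"
  define Z where "Z = D\<^sup>* `` {v}"
  define T where "T = {A. A \<subseteq> Z \<and> A \<noteq> {} \<and> r \<notin> A \<and> v \<notin> A \<and> into D A = 1}"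
  \<comment> \<open>The maximal members cover the same vertices as \<open>T\<close> but are
    disjoint, so their excesses add up.\<close>
  define M where "M = {A \<in> T. \<forall>B\<in>T. A \<subseteq> B \<longrightarrow> A = B}"
  note fin = orients_finite[OF D(1)]
  have Z_sub: "Z \<subseteq> V"
  proof
    fix x assume "x \<in> Z"
    then have "(v, x) \<in> D\<^sup>*" by (simp add: Z_def)
    then show "x \<in> V" using orients_sub[OF D(1)] v(1) by (induction rule: rtrancl_induct) auto
  qed
  then have fin_Z: "finite Z" using fin_V finite_subset by blast
  have fin_T: "finite T" by (rule finite_subset[of _ "Pow Z"]) (auto simp: T_def fin_Z)
  have T_Un: "A \<union> B \<in> T" if "A \<in> T" "B \<in> T" "A \<inter> B \<noteq> {}" for A B
  proof -
    have "A \<subseteq> V" "B \<subseteq> V" "A \<noteq> {}" "r \<notin> A" "r \<notin> B"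
      using that(1,2) Z_sub by (auto simp: T_def)
    \<comment> \<open>Both in-degrees are positive and, by submodularity, sum to at most 2.\<close>
    then have "0 < into D (A \<union> B)" "0 < into D (A \<inter> B)"
      using D(2)[unfolded rooted_def, rule_format, of "A \<union> B"]
        D(2)[unfolded rooted_def, rule_format, of "A \<inter> B"] that(3) by (simp_all add: le_infI1)
    then have "into D (A \<union> B) = 1"
      using into_submodular[OF fin, of A B] that(1,2) by (simp add: T_def)
    then show ?thesis using that by (auto simp: T_def)
  qed
  have disj: "pairwise disjnt M"
    unfolding pairwise_def
  proof (intro ballI impI)
    fix A B assume AB: "A \<in> M" "B \<in> M" "A \<noteq> B"
    show "disjnt A B"
    proof (rule ccontr)
      assume "\<not> disjnt A B"
      then have "A \<union> B \<in> T" using T_Un AB by (auto simp: M_def disjnt_def)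
      then have "A = A \<union> B" "B = A \<union> B" using AB by (auto simp: M_def)
      then show False using AB(3) by simp
    qed
  qed
  have M_Union: "\<Union>M = \<Union>T"
  proof
    show "\<Union>T \<subseteq> \<Union>M"
    proof
      fix x assume "x \<in> \<Union>T"
      then obtain A where A: "A \<in> T" "x \<in> A" by auto
      obtain B where "B \<in> T" "A \<subseteq> B" "\<forall>C\<in>T. B \<subseteq> C \<longrightarrow> C = B"
        using finite_has_maximal2[OF fin_T A(1)] by blast
      then show "x \<in> \<Union>M" using A(2) by (auto simp: M_def)
    qed
  qed (auto simp: M_def)
  have "0 \<le> excess D A" if "A \<in> M" for A
  proof -
    have A: "A \<subseteq> Z" "A \<noteq> {}" "r \<notin> A" "into D A = 1" using that by (auto simp: M_def T_def)
    \<comment> \<open>Only one of these edges is directed into \<open>A\<close>, so at least one arc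
      leaves.\<close>
    then have "2 \<le> into E A" using cut[of A] Z_sub r by auto
    then show ?thesis using A(4) into_orients[OF D(1), of A] by (simp add: excess_def)
  qed
  moreover have "excess D (\<Union>M) = (\<Sum>A\<in>M. excess D A)"
  proof (rule excess_Union[OF fin _ _ disj])
    show "finite M" using fin_T by (simp add: M_def)
    show "\<forall>A\<in>M. finite A" using fin_Z finite_subset by (auto simp: M_def T_def)
  qed
  ultimately have exc_T: "0 \<le> excess D (\<Union>T)" by (simp add: M_Union sum_nonneg)
  \<comment> \<open>Hence out-degree at least \<open>k\<close> makes the excess nonnegative, and
    out-degree above \<open>k\<close> makes it positive.\<close>
  have deg': "into D {x} + into D (- {x}) \<le> 2 * k" if "x \<in> V" for x
    using deg[OF that] into_orients[OF D(1), of "{x}"] by simp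
  have saturated: "k \<le> into D (- {w})" if w: "w \<in> Z - \<Union>T" for w
  proof (rule ccontr)
    assume less: "\<not> k \<le> into D (- {w})"
    \<comment> \<open>Restricting \<open>T\<close> to subsets of \<open>Z\<close> loses nothing
      here: a tight set around \<open>w\<close> that omits \<open>v\<close> lies in
      \<open>Z\<close>.\<close>
    have "into D B \<noteq> 1" if "B \<subseteq> V" "r \<notin> B" "v \<notin> B" "w \<in> B" for B
    proof
      assume "into D B = 1"
      then have "B \<in> T"
        using tight_subset_reachable[OF D that(1,2) _ that(3,4)] that w
        by (auto simp: T_def Z_def)
      then show False using w that(4) by auto
    qed
    moreover have "w \<in> V" "(v, w) \<in> D\<^sup>*" using w Z_sub by (auto simp: Z_def)
    ultimately show False using contra less by (meson not_le)
  qed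
  have exc_nonneg: "0 \<le> excess D {w}" if "w \<in> Z - \<Union>T" for w
    using saturated[OF that] deg'[of w] that Z_sub by (auto simp: excess_def)
  have "0 < excess D {v}" using deg'[OF v(1)] v(2) by (simp add: excess_def)
  moreover have "v \<in> Z - \<Union>T" by (auto simp: Z_def T_def)
  ultimately have "0 < (\<Sum>w\<in>Z - \<Union>T. excess D {w})"
    using exc_nonneg fin_Z by (intro sum_pos2[of _ v]) auto
  then have "0 < excess D (Z - \<Union>T)"
    using excess_eq_sum_vertices[OF fin, of "Z - \<Union>T"] fin_Z by simp
  moreover have "excess D Z = excess D (Z - \<Union>T) + excess D (\<Union>T)"
  proof -
    have "\<Union>T \<subseteq> Z" by (auto simp: T_def)
    then have "Z = (Z - \<Union>T) \<union> \<Union>T" "finite (\<Union>T)" using fin_Z finite_subset by auto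
    then show ?thesis using excess_Un[OF fin, of "Z - \<Union>T" "\<Union>T"] fin_Z by auto
  qed
  \<comment> \<open>\<open>Z\<close> is closed under arcs, so its excess cannot be positive.\<close>
  moreover have "into D (- Z) = 0"
    using into_pos_iff[OF fin, of "- Z"]
    by (auto simp: Z_def intro: rtrancl_into_rtrancl)
  ultimately show False using exc_T by (simp add: excess_def)
qed

lemma exists_rooted_bounded:
  assumes r: "r \<in> V"
    and deg: "\<And>x. x \<in> V \<Longrightarrow> into E {x} \<le> 2 * k"
  shows "\<exists>D. orients E D \<and> rooted V r D \<and> (\<forall>v\<in>V. into D (- {v}) \<le> k)"
proof -
  \<comment> \<open>Subtraction truncates at 0, so a vertex with out-degree below \<open>k\<close>
    may gain an out-arc for free.\<close>
  define \<Phi> where "\<Phi> D = (\<Sum>v\<in>V. into D (- {v}) - k)" for D :: "('a \<times> 'a) set"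
  obtain D0 where "orients E D0 \<and> rooted V r D0" using exists_rooted[OF r] ..
  then obtain D where D: "orients E D" "rooted V r D"
    and min: "\<And>D'. orients E D' \<Longrightarrow> rooted V r D' \<Longrightarrow> \<Phi> D \<le> \<Phi> D'"
    using ex_has_least_nat[of "\<lambda>D. orients E D \<and> rooted V r D" D0 \<Phi>] by blast
  have "into D (- {v}) \<le> k" if v: "v \<in> V" for v
  proof (rule ccontr)
    assume "\<not> into D (- {v}) \<le> k"
    then have k: "k < into D (- {v})" by simp
    obtain w where w: "w \<in> V" "(v, w) \<in> D\<^sup>*" "into D (- {w}) < k"
      and not_tight: "\<And>B. B \<subseteq> V \<Longrightarrow> r \<notin> B \<Longrightarrow> v \<notin> B \<Longrightarrow> w \<in> B \<Longrightarrow> into D B \<noteq> 1"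
      using exists_unsaturated[OF D r deg v k] by blast
    note fin = orients_finite[OF D(1)]
    obtain P where P: "P \<subseteq> D" "\<And>B. excess P B = of_bool (v \<in> B) - of_bool (w \<in> B)"
      using exists_path_arcs[OF fin w(2)] by blast
    define D' where "D' = (D - P) \<union> P\<inverse>"
    have o: "orients E D'" unfolding D'_def by (rule orients_reverse[OF D(1) P(1)])
    have D': "int (into D' B) = int (into D B) + of_bool (v \<in> B) - of_bool (w \<in> B)" for B
      using into_reverse[OF fin P(1), of B] D(1) P(2)[of B] by (simp add: D'_def orients_def)
    have "rooted V r D'"
      unfolding rooted_def
    proof (intro allI impI)
      fix B assume B: "B \<subseteq> V" "B \<noteq> {} \<and> r \<notin> B"
      then have "0 < into D B" using D(2) by (simp add: rooted_def)
      \<comment> \<open>\<open>B\<close> loses an arc only if it contains \<open>w\<close> but not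
        \<open>v\<close>; then it is not tight, so at least two arcs entered it.\<close>
      then show "0 < into D' B"
        using D'[of B] not_tight[of B] B by (cases "v \<in> B"; cases "w \<in> B") auto
    qed
    then have "\<Phi> D \<le> \<Phi> D'" using min o by blast
    moreover have "\<Phi> D' < \<Phi> D"
      unfolding \<Phi>_def
    proof (rule sum_strict_mono_ex1[OF fin_V])
      have "v \<noteq> w" using k w(3) by auto
      show "\<forall>x\<in>V. into D' (- {x}) - k \<le> into D (- {x}) - k"
      proof
        fix x
        show "into D' (- {x}) - k \<le> into D (- {x}) - k"
          using D'[of "- {x}"] w(3) by (cases "x = v"; cases "x = w") auto
      qed
      have "into D' (- {v}) - k < into D (- {v}) - k"
        using D'[of "- {v}"] k \<open>v \<noteq> w\<close> by auto
      then show "\<exists>x\<in>V. into D' (- {x}) - k < into D (- {x}) - k" using v by blast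
    qed
    ultimately show False by simp
  qed
  with D show ?thesis by blast
qed

end

section \<open>Greedy forcing from a root\<close>

lemma force_step_extensive: "S \<subseteq> force_step D S"
  by (auto simp: force_step_def)

lemma force_steps_extensive: "S \<subseteq> (force_step D ^^ t) S"
proof (induction t)
  case (Suc t)
  then show ?case using force_step_extensive[of "(force_step D ^^ t) S" D] by simp
qed simp

lemma force_stepI:
  assumes "v \<in> S" "card (out_neighbors D v - S) \<le> 1" "w \<in> out_neighbors D v"
  shows "w \<in> force_step D S"
proof (cases "w \<in> S")
  case False
  with assms have "w \<in> out_neighbors D v - S" by simp
  with assms(1,2) show ?thesis unfolding force_step_def by blast
qed (simp add: force_step_def)

text \<open>Growing the coloured set shrinks the set of uncoloured out-neighbours. Finiteness
  matters, since \<open>card\<close> of an infinite set is 0.\<close>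

lemma force_step_mono:
  assumes "finite (parcs D)" "S \<subseteq> S'"
  shows "force_step D S \<subseteq> force_step D S'"
proof
  fix w assume "w \<in> force_step D S"
  then consider "w \<in> S" | v where "v \<in> S" "card (out_neighbors D v - S) \<le> 1"
    "w \<in> out_neighbors D v"
    unfolding force_step_def by blast
  then show "w \<in> force_step D S'"
  proof cases
    case 1
    then show ?thesis using assms(2) force_step_extensive[of S' D] by blast
  next
    case 2
    have "out_neighbors D v = parcs D `` {v}" by (auto simp: out_neighbors_def)
    then have "finite (out_neighbors D v)" using assms(1) by simp
    then have "card (out_neighbors D v - S') \<le> card (out_neighbors D v - S)"
      using assms(2) by (intro card_mono) auto
    then show ?thesis using 2 assms(2) by (intro force_stepI[of v]) auto
  qed
qed

lemma force_steps_mono: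
  assumes "finite (parcs D)" "S \<subseteq> S'"
  shows "(force_step D ^^ t) S \<subseteq> (force_step D ^^ t) S'"
proof (induction t)
  case (Suc t)
  then show ?case using force_step_mono[OF assms(1)] by simp
qed (use assms(2) in simp)

lemma force_steps_subset:
  assumes "parcs D \<subseteq> pverts D \<times> pverts D" "S \<subseteq> pverts D"
  shows "(force_step D ^^ t) S \<subseteq> pverts D"
proof (induction t)
  case (Suc t)
  have "out_neighbors D v \<subseteq> pverts D" for v using assms(1) by (auto simp: out_neighbors_def)
  then have "force_step D A \<subseteq> pverts D" if "A \<subseteq> pverts D" for A
    using that unfolding force_step_def by blast
  with Suc show ?case by simp
qed (use assms(2) in simp)

lemma force_step_completes:
  assumes "u \<in> S" "out_neighbors D u - {x} \<subseteq> S"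
  shows "out_neighbors D u \<subseteq> force_step D S"
proof -
  have "out_neighbors D u - S \<subseteq> {x}" using assms(2) by auto
  then have "card (out_neighbors D u - S) \<le> 1" using card_mono[of "{x}"] by fastforce
  then show ?thesis using assms(1) force_stepI by fast
qed

lemma greedy_forcing_set:
  assumes fin: "finite (pverts D)"
    and sub: "parcs D \<subseteq> pverts D \<times> pverts D"
    and r: "r \<in> pverts D"
    and root: "rooted (pverts D) r (parcs D)"
    and k: "\<And>v. v \<in> pverts D \<Longrightarrow> card (out_neighbors D v) \<le> k"
  shows "\<exists>S. forcing_set D S \<and> k * card S \<le> (k - 1) * card (pverts D) + 1"
proof -
  let ?V = "pverts D"
  \<comment> \<open>Invariant of the greedy colouring. Inclusion replaces equality because
    simultaneous forcing may colour more than \<open>C\<close>. The \<open>+ 1\<close> pays for the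
    root, where \<open>C\<close> and \<open>S\<close> are both \<open>{r}\<close>.\<close>
  define Q where "Q C \<longleftrightarrow> r \<in> C \<and> C \<subseteq> ?V \<and> (\<exists>S t. r \<in> S \<and> S \<subseteq> C \<and> C \<subseteq> (force_step D ^^ t) S \<and>
    k * card S \<le> (k - 1) * card C + 1)" for C
  have fin_D: "finite (parcs D)" using fin sub finite_subset by blast
  have "Q {r}"
    unfolding Q_def using r by (auto intro!: exI[of _ "{r}"] exI[of _ 0])
  moreover have "\<forall>C. Q C \<longrightarrow> card C < Suc (card ?V)"
    using card_mono[OF fin] by (simp add: Q_def less_Suc_eq_le)
  ultimately obtain C where C: "Q C" and max: "\<And>C'. Q C' \<Longrightarrow> card C' \<le> card C"
    using ex_has_greatest_nat[of Q "{r}" card "Suc (card ?V)"] by blast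
  then obtain S t where S: "r \<in> S" "S \<subseteq> C" "C \<subseteq> (force_step D ^^ t) S"
    "k * card S \<le> (k - 1) * card C + 1"
    and C_sub: "r \<in> C" "C \<subseteq> ?V"
    by (auto simp: Q_def)
  have fin_C: "finite C" using C_sub(2) fin finite_subset by blast
  have "C = ?V"
  proof (rule ccontr)
    assume "C \<noteq> ?V"
    then have "0 < into (parcs D) (?V - C)" using root C_sub by (auto simp: rooted_def)
    then obtain u y where uy: "(u, y) \<in> parcs D" "u \<notin> ?V - C" "y \<in> ?V - C"
      unfolding into_pos_iff[OF fin_D] by blast
    have "u \<in> ?V" using uy(1) sub by auto
    then have "u \<in> C" using uy(2) by simp
    define N where "N = out_neighbors D u - C"
    have N_sub: "N \<subseteq> ?V" using sub by (auto simp: N_def out_neighbors_def)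
    then have fin_N: "finite N" using fin finite_subset by blast
    have "out_neighbors D u \<subseteq> ?V" using sub by (auto simp: out_neighbors_def)
    then have "finite (out_neighbors D u)" using fin finite_subset by blast
    then have "card N \<le> card (out_neighbors D u)" by (intro card_mono) (auto simp: N_def)
    then have "card N \<le> k" using k[OF \<open>u \<in> ?V\<close>] by simp
    have "y \<in> N" using uy(1,3) by (simp add: N_def out_neighbors_def)
    \<comment> \<open>All of \<open>N\<close> except \<open>y\<close> joins the forcing set, which
      leaves \<open>u\<close> at most \<open>y\<close> to force.\<close>
    define S' where "S' = S \<union> (N - {y})"
    have "(force_step D ^^ t) S \<subseteq> (force_step D ^^ t) S'"
      using fin_D by (rule force_steps_mono) (simp add: S'_def)
    then have CS': "C \<subseteq> (force_step D ^^ t) S'" "S' \<subseteq> (force_step D ^^ t) S'"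
      using S(3) force_steps_extensive[of S' t D] by auto
    moreover have "out_neighbors D u - {y} \<subseteq> C \<union> S'" by (auto simp: N_def S'_def)
    ultimately have "out_neighbors D u \<subseteq> force_step D ((force_step D ^^ t) S')"
      using \<open>u \<in> C\<close> by (intro force_step_completes[of _ _ _ y]) auto
    then have "C \<union> N \<subseteq> (force_step D ^^ Suc t) S'"
      using CS'(1) force_step_extensive[of "(force_step D ^^ t) S'" D] by (auto simp: N_def)
    moreover have "k * card S' \<le> (k - 1) * card (C \<union> N) + 1"
    proof -
      have j: "0 < card N" using \<open>y \<in> N\<close> fin_N by (auto simp: card_gt_0_iff)
      have "card S' \<le> card S + (card N - 1)"
        using card_Un_le[of S "N - {y}"] \<open>y \<in> N\<close> fin_N by (simp add: S'_def)
      then have "k * card S' \<le> k * card S + k * (card N - 1)"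
        by (metis add_mult_distrib2 mult_le_mono2)
      \<comment> \<open>The right side minus the left is \<open>k - card N\<close>; here the
        out-degree bound enters.\<close>
      also have "k * (card N - 1) \<le> (k - 1) * card N"
        using j \<open>card N \<le> k\<close> by (simp add: diff_mult_distrib diff_mult_distrib2)
      finally have "k * card S' \<le> (k - 1) * card C + 1 + (k - 1) * card N" using S(4) by simp
      moreover have "card (C \<union> N) = card C + card N"
        using fin_C fin_N by (intro card_Un_disjoint) (auto simp: N_def)
      ultimately show ?thesis by (simp add: algebra_simps)
    qed
    moreover have "r \<in> S'" "S' \<subseteq> C \<union> N" using S(1,2) by (auto simp: S'_def)
    ultimately have "Q (C \<union> N)" using C_sub N_sub unfolding Q_def by blast
    then have "card (C \<union> N) \<le> card C" by (rule max)
    moreover have "card C < card (C \<union> N)"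
      using \<open>y \<in> N\<close> uy(3) fin_C fin_N by (intro psubset_card_mono) auto
    ultimately show False by simp
  qed
  then have "forcing_set D S"
    using S force_steps_subset[OF sub, of S t] by (auto simp: forcing_set_def)
  with S(4) \<open>C = ?V\<close> show ?thesis by blast
qed

text \<open>\<open>Min\<close> bounds its members only on finite sets: an orientation is determined
  by a subset of \<open>parcs G\<close>.\<close>

lemma mof_le_card:
  assumes fin: "finite (pverts G)" "finite (parcs G)"
    and D: "orientation G D" and S: "forcing_set D S"
  shows "mof G \<le> card S"
proof -
  have "{D. orientation G D} \<subseteq> (\<lambda>A. \<lparr>pverts = pverts G, parcs = A\<rparr>) ` Pow (parcs G)"
  proof
    fix D' assume "D' \<in> {D. orientation G D}"
    then have "D' = \<lparr>pverts = pverts G, parcs = parcs D'\<rparr>" "parcs D' \<in> Pow (parcs G)"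
      by (auto simp: orientation_def)
    then show "D' \<in> (\<lambda>A. \<lparr>pverts = pverts G, parcs = A\<rparr>) ` Pow (parcs G)" by (rule image_eqI)
  qed
  then have "finite {D. orientation G D}" using fin(2) finite_subset by blast
  then have mof_le: "mof G \<le> forcing_number D" unfolding mof_def using D by (intro Min_le) auto
  have "{S. forcing_set D S} \<subseteq> Pow (pverts D)" by (auto simp: forcing_set_def)
  moreover have "finite (pverts D)" using D fin(1) by (simp add: orientation_def)
  ultimately have "finite {S. forcing_set D S}" using finite_subset by blast
  then have "forcing_number D \<le> card S" unfolding forcing_number_def using S by (intro Min_le) auto
  with mof_le show ?thesis by simp
qed

section \<open>Two-edge-connected pair graphs\<close>

text \<open>A walk from \<open>A\<close> to its complement in the symmetric closure must cross; the
  arc of \<open>H\<close> behind the crossing may point either way.\<close>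

lemma connected_cut:
  fixes H :: "'a pair_pre_digraph"
  assumes "Digraph_Component.connected (with_proj H)" "A \<subseteq> pverts H" "A \<noteq> {}" "A \<noteq> pverts H"
  shows "\<exists>(a, b)\<in>parcs H. a \<in> A \<longleftrightarrow> b \<notin> A"
proof (rule ccontr)
  assume contra: "\<not> ?thesis"
  obtain x y where xy: "x \<in> A" "y \<in> pverts H - A" using assms(2-4) by auto
  then have "(x, y) \<in> (arcs_ends (with_proj (mk_symmetric (with_proj H))))\<^sup>*"
    using assms(1,2)
    by (intro reachable_rtranclI) (auto simp: Digraph_Component.connected_def strongly_connected_def)
  then have "y \<in> A"
    by (induction rule: rtrancl_induct) (use xy contra in \<open>auto simp: arcs_ends_conv parcs_mk_symmetric\<close>)
  then show False using xy by simp
qed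

lemma edge_connected_imp_bridgeless:
  assumes "pair_graph G" "edge_connected 2 G"
  shows "bridgeless (pverts G) (parcs G)"
proof
  interpret pair_graph G by fact
  show "finite (pverts G)" by simp
  show "parcs G \<subseteq> pverts G \<times> pverts G" using in_arcsD1 in_arcsD2 by auto
  show "sym (parcs G)" using sym_arcs by (simp add: symmetric_def arcs_ends_conv)
  show "irrefl (parcs G)" using no_loops[of "(a, a)" for a] by (intro irreflI) force
  fix A assume A: "A \<subseteq> pverts G" "A \<noteq> {}" "A \<noteq> pverts G"
  define X where "X = parcs G \<inter> (- A) \<times> A"
  \<comment> \<open>Deleting these undirected edges separates \<open>A\<close> from the rest; there
    are at most \<open>card X\<close> of them.\<close>
  define F where "F = (\<lambda>(a, b). {a, b}) ` X"
  show "2 \<le> into (parcs G) A"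
  proof (rule ccontr)
    assume "\<not> 2 \<le> into (parcs G) A"
    then have "card X < 2" by (simp add: into_def X_def)
    then have "card F < 2"
      using card_image_le[of X "\<lambda>(a, b). {a, b}"] by (simp add: F_def X_def)
    moreover have "F \<subseteq> edge_set G" by (auto simp: F_def X_def edge_set_def)
    ultimately have "Digraph_Component.connected (with_proj (del_edges G F))"
      using assms(2) by (simp add: edge_connected_def)
    then obtain a b where "(a, b) \<in> parcs G" "{a, b} \<notin> F" "a \<in> A \<longleftrightarrow> b \<notin> A"
      using connected_cut[of "del_edges G F" A] A by (auto simp: del_edges_def)
    moreover have "(b, a) \<in> parcs G" using \<open>sym (parcs G)\<close> \<open>(a, b) \<in> parcs G\<close> by (simp add: symD)
    ultimately have "(a, b) \<in> X \<or> (b, a) \<in> X" by (auto simp: X_def)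
    then have "{a, b} \<in> F" by (force simp: F_def insert_commute)
    then show False using \<open>{a, b} \<notin> F\<close> by simp
  qed
qed

section \<open>Degrees and orientations of pair graphs, and the final bound\<close>

lemma orients_imp_orientation:
  assumes "orients (parcs G) D"
  shows "orientation G \<lparr>pverts = pverts G, parcs = D\<rparr>"
  using assms by (auto simp: orients_def orientation_def)

lemma into_compl_singleton:
  assumes "irrefl D"
  shows "into D (- {v}) = card {w. (v, w) \<in> D}"
proof -
  have "D \<inter> (- (- {v})) \<times> (- {v}) = Pair v ` {w. (v, w) \<in> D}"
    using assms by (auto simp: irrefl_def)
  then show ?thesis by (simp add: into_def card_image inj_on_def)
qed

lemma out_degree_with_proj:
  "out_degree (with_proj G) v = card {w. (v, w) \<in> parcs G}"
proof -
  have "out_arcs (with_proj G) v = Pair v ` {w. (v, w) \<in> parcs G}"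
    by (auto simp: out_arcs_def)
  then show ?thesis by (simp add: out_degree_def card_image inj_on_def)
qed

theorem theorem3p9:
  fixes G :: "'a pair_pre_digraph" and n \<Delta> :: nat
  assumes "pair_graph G"
    and "edge_connected 2 G"
    and "n = card (pverts G)"
    and "\<Delta> = max_degree G"
  shows "real (mof G) \<le>
    ((of_int \<lceil>real \<Delta> / 2\<rceil> - 1) * real n + 1) / of_int \<lceil>real \<Delta> / 2\<rceil>"
proof -
  interpret bridgeless "pverts G" "parcs G"
    using assms(1,2) by (rule edge_connected_imp_bridgeless)
  define k where "k = nat \<lceil>real \<Delta> / 2\<rceil>"
  have k: "real_of_int \<lceil>real \<Delta> / 2\<rceil> = real k"
    by (simp add: k_def)
  have "1 < card (pverts G)" using assms(2) by (simp add: edge_connected_def)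
  then obtain r where r: "r \<in> pverts G" by fastforce
  have into_deg: "into (parcs G) {x} = out_degree (with_proj G) x" for x
  proof -
    have "parcs G \<inter> (- {x}) \<times> {x} = (parcs G \<inter> {x} \<times> (- {x}))\<inverse>" using E_sym by (auto simp: sym_def)
    then have "into (parcs G) {x} = into (parcs G) (- {x})" by (simp add: into_def)
    then show ?thesis by (simp add: into_compl_singleton[OF E_irrefl] out_degree_with_proj)
  qed
  have deg: "into (parcs G) {x} \<le> \<Delta>" if "x \<in> pverts G" for x
    unfolding into_deg assms(4) max_degree_def using that fin_V by (intro Max_ge) auto
  have "{r} \<noteq> pverts G" using \<open>1 < card (pverts G)\<close> by (metis is_singletonI is_singleton_altdef less_irrefl)
  \<comment> \<open>The cut around \<open>r\<close> gives degree at least 2, so \<open>k\<close> is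
    positive, as the division and \<open>k - 1\<close> require.\<close>
  then have "0 < \<Delta>" using cut[of "{r}"] deg[OF r] r by auto
  then have "0 < k" by (simp add: k_def)
  have "\<Delta> \<le> 2 * k" unfolding k_def by linarith
  then obtain D where D: "orients (parcs G) D" "rooted (pverts G) r D"
    "\<forall>v\<in>pverts G. into D (- {v}) \<le> k"
    using exists_rooted_bounded[OF r, of k] deg le_trans by metis
  let ?D = "\<lparr>pverts = pverts G, parcs = D\<rparr>"
  have "irrefl D" using D(1) E_irrefl by (auto simp: irrefl_def orients_def)
  then obtain S where S: "forcing_set ?D S" "k * card S \<le> (k - 1) * card (pverts G) + 1"
    using greedy_forcing_set[of ?D r k] D fin_V r orients_sub[OF D(1)]
    by (auto simp: out_neighbors_def into_compl_singleton)
  have "k * mof G \<le> k * card S"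
    using mof_le_card[OF fin_V fin_E orients_imp_orientation[OF D(1)] S(1)] by simp
  also note S(2)
  finally have "real (k * mof G) \<le> real ((k - 1) * card (pverts G) + 1)" by (rule of_nat_mono)
  then have "real k * real (mof G) \<le> (real k - 1) * real n + 1"
    using \<open>0 < k\<close> assms(3) by simp
  then show ?thesis using \<open>0 < k\<close> by (simp add: k pos_le_divide_eq mult.commute)
qed

end
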